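(* As $n\to\infty$, $\operatorname{lc}_{\mathfrak{CB}}(G_{P(1,2;n)})=\Theta(\log n)$.
   Context: $P(1,2;n)$ is the subposet of the Boolean lattice of subsets of $[n]=\{1,\dots,n\}$ (ordered by inclusion) induced by all $1$-element and all $2$-element subsets. $G_{P(1,2;n)}$ is the bipartite graph whose parts are the $1$-element subsets and the $2$-element subsets, where $\{a\}$ and $\{b,c\}$ are adjacent iff $\{a\}\not\subseteq\{b,c\}$, i.e., iff $a\notin\{b,c\}$. For a class $\mathfrak{F}$ of graphs and a graph $H$, an $\mathfrak{F}$-covering of $H$ is a set of subgraphs $G_1,\dots,G_t$ of $H$, each in $\mathfrak{F}$, whose union is $H$; it is $k$-local if every vertex lies in at most $k$ of the $G_i$; $\operatorname{lc}_{\mathfrak{F}}(H)$ is the least such $k$. $\mathfrak{CB}$ is the class of complete bipartite graphs. *)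

theory Defs
  imports
    Complex_Main
    "HOL-Library.Landau_Symbols"
    "Graph_Theory.Graph_Theory"
begin

text \<open>
  Undirected simple graphs are represented as symmetric loop-free digraphs (\<^locale>\<open>pair_graph\<close>):
  an undirected edge is the pair of arcs \<open>(u, v)\<close> and \<open>(v, u)\<close>.
\<close>

text \<open>
  Both parts are required to be nonempty.  Isolated vertices of \<open>H\<close> are then not coverable,
  but \<open>G_P12 n\<close> below has none for \<open>n \<ge> 3\<close>, so this convention affects only \<open>n \<le> 2\<close>.
\<close>

definition complete_bipartite_graphs :: "'a pair_pre_digraph set" where
  "complete_bipartite_graphs =
     {G. \<exists>m>0. \<exists>n>0. complete_bipartite_digraph m n (with_proj G)}"

definition covering ::
  "'a pair_pre_digraph set \<Rightarrow> 'a pair_pre_digraph \<Rightarrow> 'a pair_pre_digraph set \<Rightarrow> bool" where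
  "covering F H C \<longleftrightarrow>
     finite C \<and> C \<subseteq> F \<and> (\<forall>G\<in>C. subgraph (with_proj G) (with_proj H)) \<and>
     (\<Union>G\<in>C. pverts G) = pverts H \<and> (\<Union>G\<in>C. parcs G) = parcs H"

definition local_covering ::
  "nat \<Rightarrow> 'a pair_pre_digraph set \<Rightarrow> 'a pair_pre_digraph \<Rightarrow> 'a pair_pre_digraph set \<Rightarrow> bool" where
  "local_covering k F H C \<longleftrightarrow>
     covering F H C \<and> (\<forall>v\<in>pverts H. card {G \<in> C. v \<in> pverts G} \<le> k)"

text \<open>Meaningful only if \<open>H\<close> has an \<open>F\<close>-covering; otherwise the value is unspecified.\<close>

definition lc :: "'a pair_pre_digraph set \<Rightarrow> 'a pair_pre_digraph \<Rightarrow> nat" where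
  "lc F H = (LEAST k. \<exists>C. local_covering k F H C)"

definition layer :: "nat \<Rightarrow> nat \<Rightarrow> nat set set" where
  "layer k n = {A. A \<subseteq> {1..n} \<and> card A = k}"

definition G_P12 :: "nat \<Rightarrow> nat set pair_pre_digraph" where
  "G_P12 n =
     (let E = {(A, B). A \<in> layer 1 n \<and> B \<in> layer 2 n \<and> \<not> A \<subseteq> B}
      in \<lparr> pverts = layer 1 n \<union> layer 2 n, parcs = E \<union> E\<inverse> \<rparr>)"

lemma finite_layer: "finite (layer k n)"
  unfolding layer_def by (rule finite_subset[of _ "Pow {1..n}"]) auto

lemma pair_graph_G_P12: "pair_graph (G_P12 n)"
proof -
  have "finite (parcs (G_P12 n))"
    by (rule finite_subset[of _ "pverts (G_P12 n) \<times> pverts (G_P12 n)"])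
      (auto simp: G_P12_def Let_def finite_layer)
  then show ?thesis
    by unfold_locales
      (auto simp: G_P12_def Let_def finite_layer symmetric_def intro!: symI)
qed

end

theory Submission
  imports Defs
begin

text \<open>
  Upper bound: for \<open>S \<subseteq> {1..n}\<close> the singletons inside \<open>S\<close> and the pairs disjoint from \<open>S\<close> span a
  biclique. A uniformly random \<open>S\<close> covers a given edge with probability \<open>1/8\<close>, and there are at most
  \<open>n\<^sup>3\<close> edges, so \<open>O(log n)\<close> random sets cover everything, even globally.

  Lower bound (after Hansel): the vertices \<open>{j}\<close> and \<open>{j, n}\<close> with \<open>j < n\<close> induce a complete bipartite
  graph minus a perfect matching. Given a \<open>k\<close>-local covering, delete from each biclique one of its
  sides at random. The index \<open>j\<close> survives if neither \<open>{j}\<close> nor \<open>{j, n}\<close> is ever deleted, which has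
  probability at least \<open>4\<^sup>-\<^sup>k\<close>; but two different indices never survive together, whence
  \<open>n - 1 \<le> 4\<^sup>k\<close>.
\<close>

section \<open>Counting\<close>

text \<open>Only membership of the elements outside \<open>P\<close> and \<open>Q\<close> is free,
  so a random subset of \<open>X\<close> qualifies with probability 2^-(|P|+|Q|). The product form
  stays in the natural numbers. Both bounds use this count.\<close>

lemma card_sets_between:
  assumes "finite X" "P \<subseteq> X" "Q \<subseteq> X" "P \<inter> Q = {}"
  shows "2 ^ (card P + card Q) * card {S. P \<subseteq> S \<and> S \<subseteq> X \<and> S \<inter> Q = {}} = 2 ^ card X"
proof -
  have fin: "finite P" "finite Q"
    using assms by (auto intro: finite_subset)
  have "{S. P \<subseteq> S \<and> S \<subseteq> X \<and> S \<inter> Q = {}} = (\<union>) P ` Pow (X - (P \<union> Q))"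
  proof (intro set_eqI iffI)
    fix S assume "S \<in> {S. P \<subseteq> S \<and> S \<subseteq> X \<and> S \<inter> Q = {}}"
    then have "S = P \<union> (S - P)" "S - P \<in> Pow (X - (P \<union> Q))" by auto
    then show "S \<in> (\<union>) P ` Pow (X - (P \<union> Q))" by blast
  qed (use assms in auto)
  moreover have "inj_on ((\<union>) P) (Pow (X - (P \<union> Q)))"
    by (rule inj_onI) blast
  moreover have "card P + card Q + card (X - (P \<union> Q)) = card X"
    using assms fin
    by (metis Un_least card_Diff_subset card_Un_disjoint card_mono finite_UnI
        le_add_diff_inverse)
  ultimately show ?thesis
    using assms by (simp add: card_image card_Pow flip: power_add)
qed

text \<open>Union bound over \<open>k\<close> independent uniform choices from \<open>Y\<close>: a
  fixed \<open>t\<close> is missed by all of them with probability at most (p/q)^k, and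
  \<open>small\<close> makes the sum of these over \<open>T\<close> less than 1.\<close>

lemma exists_small_hitting_set:
  fixes R :: "'a \<Rightarrow> 'b \<Rightarrow> bool"
  assumes "finite T" "finite Y"
    and miss: "\<And>t. t \<in> T \<Longrightarrow> q * card {y \<in> Y. \<not> R t y} \<le> p * card Y"
    and small: "card T * p ^ k < q ^ k" and "Y \<noteq> {}"
  shows "\<exists>F\<subseteq>Y. finite F \<and> card F \<le> k \<and> (\<forall>t\<in>T. \<exists>y\<in>F. R t y)"
proof -
  \<comment> \<open>Choices are \<open>k\<close>-tuples with repetition, so their number is an exact
    power; repetitions only shrink the resulting set \<open>F\<close>.\<close>
  define bad where "bad t = {..<k} \<rightarrow>\<^sub>E {y \<in> Y. \<not> R t y}" for t
  have bad: "q ^ k * card (bad t) \<le> p ^ k * card Y ^ k" if "t \<in> T" for t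
    using power_mono[OF miss[OF that], of k] by (simp add: bad_def card_funcsetE power_mult_distrib)
  have "q ^ k * card (\<Union>t\<in>T. bad t) \<le> q ^ k * (\<Sum>t\<in>T. card (bad t))"
    using \<open>finite T\<close> by (intro mult_le_mono2 card_UN_le)
  also have "\<dots> = (\<Sum>t\<in>T. q ^ k * card (bad t))"
    by (rule sum_distrib_left)
  also have "\<dots> \<le> card T * (p ^ k * card Y ^ k)"
    using sum_bounded_above[of T "\<lambda>t. q ^ k * card (bad t)" "p ^ k * card Y ^ k"] bad by simp
  also have "\<dots> < q ^ k * card Y ^ k"
    using small assms by (simp add: card_gt_0_iff)
  finally have "card (\<Union>t\<in>T. bad t) < card ({..<k} \<rightarrow>\<^sub>E Y)"
    by (simp add: card_funcsetE)
  moreover have "finite (\<Union>t\<in>T. bad t)"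
    using assms by (auto simp: bad_def intro!: finite_PiE)
  ultimately have "\<not> ({..<k} \<rightarrow>\<^sub>E Y) \<subseteq> (\<Union>t\<in>T. bad t)"
    by (meson card_mono not_le)
  then obtain f where f: "f \<in> {..<k} \<rightarrow>\<^sub>E Y" "\<forall>t\<in>T. f \<notin> bad t"
    by blast
  have "\<exists>y\<in>f ` {..<k}. R t y" if "t \<in> T" for t
    using f that by (force simp: bad_def PiE_iff)
  moreover have "f ` {..<k} \<subseteq> Y" using f by auto
  moreover have "card (f ` {..<k}) \<le> k"
    using card_image_le[of "{..<k}" f] by simp
  ultimately show ?thesis by blast
qed

text \<open>A Bollobas-type inequality. The events "\<open>D\<close> contains \<open>P i\<close> and
  avoids \<open>Q i\<close>" for random \<open>D\<close> are pairwise disjoint, and each has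
  probability at least 2^-m, so there are at most 2^m of them.\<close>

lemma card_le_cross_intersecting:
  assumes "finite C" "finite I"
    and sub: "\<And>i. i \<in> I \<Longrightarrow> P i \<subseteq> C \<and> Q i \<subseteq> C \<and> P i \<inter> Q i = {}"
    and cross: "\<And>i j. i \<in> I \<Longrightarrow> j \<in> I \<Longrightarrow> i \<noteq> j \<Longrightarrow> P i \<inter> Q j \<noteq> {}"
    and size: "\<And>i. i \<in> I \<Longrightarrow> card (P i) + card (Q i) \<le> m"
  shows "card I \<le> 2 ^ m"
proof -
  define A where "A i = {D. P i \<subseteq> D \<and> D \<subseteq> C \<and> D \<inter> Q i = {}}" for i
  have A_sub: "A i \<subseteq> Pow C" for i by (auto simp: A_def)
  have A_fin: "finite (A i)" for i
    using assms(1) by (intro finite_subset[OF A_sub]) simp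
  \<comment> \<open>A common member would contain \<open>P i\<close> and avoid \<open>Q j\<close>,
    although these two intersect.\<close>
  have "A i \<inter> A j = {}" if "i \<in> I" "j \<in> I" "i \<noteq> j" for i j
    using cross[OF that] by (fastforce simp: A_def)
  then have "(\<Sum>i\<in>I. card (A i)) = card (\<Union>i\<in>I. A i)"
    using assms(2) A_fin by (intro card_UN_disjoint[symmetric]) auto
  also have "\<dots> \<le> card (Pow C)"
    using assms(1) A_sub by (intro card_mono) auto
  finally have le: "(\<Sum>i\<in>I. card (A i)) \<le> 2 ^ card C"
    using assms(1) by (simp add: card_Pow)
  have "2 ^ card C \<le> 2 ^ m * card (A i)" if "i \<in> I" for i
  proof -
    have "2 ^ card C = 2 ^ (card (P i) + card (Q i)) * card (A i)"
      unfolding A_def using sub[OF that] assms(1) by (subst card_sets_between) auto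
    also have "\<dots> \<le> 2 ^ m * card (A i)"
      using size[OF that] by (intro mult_le_mono1 power_increasing) auto
    finally show ?thesis .
  qed
  then have "card I * 2 ^ card C \<le> (\<Sum>i\<in>I. 2 ^ m * card (A i))"
    using sum_bounded_below[of I "2 ^ card C" "\<lambda>i. 2 ^ m * card (A i)"] by simp
  also have "\<dots> \<le> 2 ^ m * 2 ^ card C"
    using le by (simp flip: sum_distrib_left)
  finally show ?thesis by simp
qed

section \<open>Bicliques\<close>

definition biclique :: "'a set \<Rightarrow> 'a set \<Rightarrow> 'a pair_pre_digraph" where
  "biclique U V = \<lparr> pverts = U \<union> V, parcs = U \<times> V \<union> V \<times> U \<rparr>"

lemma biclique_simps [simp]:
  "pverts (biclique U V) = U \<union> V"
  "parcs (biclique U V) = U \<times> V \<union> V \<times> U"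
  by (simp_all add: biclique_def)

lemma complete_bipartite_graphs_iff:
  "G \<in> complete_bipartite_graphs \<longleftrightarrow>
     (\<exists>U V. finite U \<and> finite V \<and> U \<noteq> {} \<and> V \<noteq> {} \<and> U \<inter> V = {} \<and> G = biclique U V)"
proof
  assume "G \<in> complete_bipartite_graphs"
  then obtain U V where "finite (pverts G)" "pverts G = U \<union> V" "U \<inter> V = {}"
      "0 < card U" "0 < card V" "parcs G = U \<times> V \<union> V \<times> U"
    unfolding complete_bipartite_graphs_def complete_bipartite_digraph_pair_def by blast
  then have "finite U \<and> finite V \<and> U \<noteq> {} \<and> V \<noteq> {} \<and> U \<inter> V = {} \<and> G = biclique U V"
    by (simp add: card_gt_0_iff biclique_def pair_pre_digraph.equality)
  then show "\<exists>U V. finite U \<and> finite V \<and> U \<noteq> {} \<and> V \<noteq> {} \<and> U \<inter> V = {} \<and> G = biclique U V"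
    by blast
next
  assume "\<exists>U V. finite U \<and> finite V \<and> U \<noteq> {} \<and> V \<noteq> {} \<and> U \<inter> V = {} \<and> G = biclique U V"
  then obtain U V where UV: "finite U" "finite V" "U \<noteq> {}" "V \<noteq> {}" "U \<inter> V = {}" "G = biclique U V"
    by blast
  then have "complete_bipartite_digraph (card U) (card V) (with_proj G)"
    unfolding complete_bipartite_digraph_pair_def by auto
  moreover have "0 < card U" "0 < card V"
    using UV by (simp_all add: card_gt_0_iff)
  ultimately show "G \<in> complete_bipartite_graphs"
    unfolding complete_bipartite_graphs_def by blast
qed

lemma subgraph_biclique:
  assumes "pair_wf_digraph H" "U \<union> V \<subseteq> pverts H" "U \<times> V \<union> V \<times> U \<subseteq> parcs H"
  shows "subgraph (with_proj (biclique U V)) (with_proj H)"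
proof -
  have "pair_wf_digraph (biclique U V)"
    by unfold_locales auto
  then show ?thesis
    using assms by (simp add: subgraph_def compatible_def wf_digraph_wp_iff)
qed

section \<open>Vertices and arcs of the host graph\<close>

lemma pverts_G_P12: "pverts (G_P12 n) = layer 1 n \<union> layer 2 n"
  by (simp add: G_P12_def Let_def)

lemma parcs_G_P12:
  "(A, B) \<in> parcs (G_P12 n) \<longleftrightarrow>
     A \<in> layer 1 n \<and> B \<in> layer 2 n \<and> \<not> A \<subseteq> B \<or> B \<in> layer 1 n \<and> A \<in> layer 2 n \<and> \<not> B \<subseteq> A"
  by (auto simp: G_P12_def Let_def)

lemma layer_1_eq: "layer (Suc 0) n = (\<lambda>a. {a}) ` {1..n}"
  by (auto simp: layer_def card_1_singleton_iff)

lemma layer_disjoint: "k \<noteq> l \<Longrightarrow> layer k n \<inter> layer l n = {}"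
  by (auto simp: layer_def)

section \<open>The upper bound\<close>

lemma card_layer_2_le: "card (layer 2 n) \<le> n ^ 2"
proof (cases "2 \<le> n")
  case True
  then show ?thesis
    using binomial_le_pow[of 2 n] by (simp add: layer_def n_subsets)
qed (simp add: layer_def n_subsets binomial_eq_0)

lemma separating_family:
  assumes "n ^ 3 * 7 ^ k < (8::nat) ^ k"
  shows "\<exists>F\<subseteq>Pow {1..n}. finite F \<and> card F \<le> k \<and>
    (\<forall>a\<in>{1..n}. \<forall>B\<in>layer 2 n. a \<notin> B \<longrightarrow> (\<exists>S\<in>F. a \<in> S \<and> S \<inter> B = {}))"
proof -
  define T where "T = {(a, B). a \<in> {1..n} \<and> B \<in> layer 2 n \<and> a \<notin> B}"
  define R :: "nat \<times> nat set \<Rightarrow> nat set \<Rightarrow> bool"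
    where "R = (\<lambda>(a, B) S. a \<in> S \<and> S \<inter> B = {})"
  have T_sub: "T \<subseteq> {1..n} \<times> layer 2 n" by (auto simp: T_def)
  then have finT: "finite T"
    by (rule finite_subset) (simp add: finite_layer)
  have "card T \<le> card ({1..n} \<times> layer 2 n)"
    using T_sub by (intro card_mono) (simp_all add: finite_layer)
  also have "\<dots> \<le> n * n ^ 2"
    using card_layer_2_le[of n] by (simp add: card_cartesian_product)
  finally have "card T \<le> n ^ 3" by (simp add: power3_eq_cube power2_eq_square)
  then have small: "card T * 7 ^ k < 8 ^ k"
    using assms by (meson le_less_trans mult_le_mono1)
  \<comment> \<open>A hit prescribes three memberships, \<open>a\<close> inside and the two elements
    of \<open>B\<close> outside. Hence exactly 1/8 of all subsets hit and 7/8 miss.\<close>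
  have miss: "8 * card {S \<in> Pow {1..n}. \<not> R t S} \<le> 7 * card (Pow {1..n})" if t: "t \<in> T" for t
  proof -
    obtain a B where aB: "t = (a, B)" "a \<in> {1..n}" "B \<subseteq> {1..n}" "card B = 2" "a \<notin> B"
      using t by (auto simp: T_def layer_def)
    let ?hit = "{S \<in> Pow {1..n}. R t S}"
    have "?hit = {S. {a} \<subseteq> S \<and> S \<subseteq> {1..n} \<and> S \<inter> B = {}}"
      by (auto simp: R_def aB(1))
    then have hit: "8 * card ?hit = card (Pow {1..n})"
      using card_sets_between[of "{1..n}" "{a}" B] aB by (simp add: card_Pow)
    have "{S \<in> Pow {1..n}. \<not> R t S} = Pow {1..n} - ?hit" by auto
    then have "card {S \<in> Pow {1..n}. \<not> R t S} = card (Pow {1..n}) - card ?hit"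
      by (simp only:) (rule card_Diff_subset, auto)
    then show ?thesis using hit by linarith
  qed
  obtain F where "F \<subseteq> Pow {1..n}" "finite F" "card F \<le> k" "\<forall>t\<in>T. \<exists>S\<in>F. R t S"
    using exists_small_hitting_set[of T "Pow {1..n}" 8 R 7 k] finT miss small by auto
  then show ?thesis
    by (intro exI[of _ F]) (auto simp: T_def R_def)
qed

lemma ex_local_covering_G_P12:
  assumes "3 \<le> n" and "n ^ 3 * 7 ^ k < (8::nat) ^ k"
  shows "\<exists>C. local_covering k complete_bipartite_graphs (G_P12 n) C"
proof -
  obtain F where F: "F \<subseteq> Pow {1..n}" "finite F" "card F \<le> k"
    and sep: "\<And>a B. a \<in> {1..n} \<Longrightarrow> B \<in> layer 2 n \<Longrightarrow> a \<notin> B \<Longrightarrow> \<exists>S\<in>F. a \<in> S \<and> S \<inter> B = {}"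
    using separating_family[OF assms(2)] by metis
  define U where "U S = (\<lambda>a. {a}) ` S" for S :: "nat set"
  define V where "V S = {B \<in> layer 2 n. S \<inter> B = {}}" for S
  \<comment> \<open>Members of the class have nonempty sides, so degenerate sets are dropped. No arc
    is lost: a set that covers an arc has an endpoint of it on each side.\<close>
  define F' where "F' = {S \<in> F. U S \<noteq> {} \<and> V S \<noteq> {}}"
  define C where "C = (\<lambda>S. biclique (U S) (V S)) ` F'"
  have U: "U S \<subseteq> layer 1 n" if "S \<in> F" for S
    using F(1) that by (auto simp: U_def layer_1_eq)
  have V: "V S \<subseteq> layer 2 n" for S by (auto simp: V_def)
  have UV: "U S \<times> V S \<union> V S \<times> U S \<subseteq> parcs (G_P12 n)" if "S \<in> F" for S
  proof -
    have "A \<in> layer 1 n \<and> B \<in> layer 2 n \<and> \<not> A \<subseteq> B" if "A \<in> U S" "B \<in> V S" for A B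
      using that U[OF \<open>S \<in> F\<close>] by (auto simp: U_def V_def)
    then show ?thesis by (auto simp: parcs_G_P12)
  qed
  have arc: "\<exists>G\<in>C. (A, B) \<in> parcs G \<and> (B, A) \<in> parcs G"
    if A: "A \<in> layer 1 n" and B: "B \<in> layer 2 n" and AB: "\<not> A \<subseteq> B" for A B
  proof -
    obtain a where "A = {a}" "a \<in> {1..n}"
      using A by (auto simp: layer_1_eq)
    with AB have a: "A = {a}" "a \<in> {1..n}" "a \<notin> B" by simp_all
    obtain S where "S \<in> F" "a \<in> S" "S \<inter> B = {}"
      using sep[OF a(2) B a(3)] by blast
    then have "A \<in> U S" "B \<in> V S" "S \<in> F'"
      using a B by (auto simp: U_def V_def F'_def)
    then show ?thesis unfolding C_def by auto
  qed
  have sub: "subgraph (with_proj G) (with_proj (G_P12 n))" if G: "G \<in> C" for G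
  proof -
    obtain S where S: "S \<in> F" "G = biclique (U S) (V S)"
      using G by (auto simp: C_def F'_def)
    have "pair_wf_digraph (G_P12 n)"
      using pair_graph_G_P12 pair_graph.axioms(1) pair_digraph.axioms(1) pair_fin_digraph.axioms(1)
      by blast
    then show ?thesis
      unfolding S(2) using U[OF S(1)] V[of S] UV[OF S(1)]
      by (intro subgraph_biclique) (auto simp: pverts_G_P12)
  qed
  \<comment> \<open>Covering the arcs covers the vertices once none is isolated. This is where
    \<open>3 \<le> n\<close> enters: two elements remain besides \<open>a\<close>, and no pair
    exhausts \<open>{1..n}\<close>.\<close>
  have verts: "v \<in> (\<Union>G\<in>C. pverts G)" if "v \<in> pverts (G_P12 n)" for v
  proof -
    have "\<exists>w. (v, w) \<in> parcs (G_P12 n)"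
    proof (cases "v \<in> layer 1 n")
      case True
      then obtain a where a: "v = {a}" "a \<in> {1..n}" by (auto simp: layer_1_eq)
      have "2 \<le> card ({1..n} - {a})" using a assms(1) by simp
      then obtain B where "B \<subseteq> {1..n} - {a}" "card B = 2"
        by (meson obtain_subset_with_card_n)
      then have "B \<in> layer 2 n" "\<not> v \<subseteq> B" using a by (auto simp: layer_def)
      then show ?thesis using True by (auto simp: parcs_G_P12)
    next
      case False
      then have v: "v \<in> layer 2 n" using that by (auto simp: pverts_G_P12)
      then have "card v = 2" "finite v"
        by (auto simp: layer_def card_ge_0_finite)
      then have "\<not> {1..n} \<subseteq> v"
        using card_mono[of v "{1..n}"] assms(1) by auto
      then obtain a where "a \<in> {1..n}" "a \<notin> v" by blast
      then have "{a} \<in> layer 1 n" "\<not> {a} \<subseteq> v" by (auto simp: layer_1_eq)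
      then show ?thesis using v by (auto simp: parcs_G_P12)
    qed
    then obtain w G where "G \<in> C" "(v, w) \<in> parcs G"
      using arc by (auto simp: parcs_G_P12) blast+
    then show ?thesis by (auto simp: C_def)
  qed
  have "C \<subseteq> complete_bipartite_graphs"
  proof
    fix G assume "G \<in> C"
    then obtain S where S: "S \<in> F'" "G = biclique (U S) (V S)" by (auto simp: C_def)
    then have "finite (U S)" "finite (V S)" "U S \<inter> V S = {}"
      using U[of S] V[of S] layer_disjoint[of 1 2 n] finite_layer
      by (auto simp: F'_def intro: finite_subset)
    then show "G \<in> complete_bipartite_graphs"
      using S by (auto simp: complete_bipartite_graphs_iff F'_def)
  qed
  moreover have finC: "finite C" using F(2) by (simp add: C_def F'_def)
  moreover have "(\<Union>G\<in>C. pverts G) = pverts (G_P12 n)"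
    using verts sub by (auto simp: subgraph_def)
  moreover have "(\<Union>G\<in>C. parcs G) = parcs (G_P12 n)"
  proof
    show "(\<Union>G\<in>C. parcs G) \<subseteq> parcs (G_P12 n)"
      using sub by (auto simp: subgraph_def)
    show "parcs (G_P12 n) \<subseteq> (\<Union>G\<in>C. parcs G)"
      using arc by (fastforce simp: parcs_G_P12)
  qed
  \<comment> \<open>Locality comes for free, as the whole covering has at most \<open>k\<close>
    members.\<close>
  moreover have "card {G \<in> C. v \<in> pverts G} \<le> k" for v
  proof -
    have "card {G \<in> C. v \<in> pverts G} \<le> card C"
      using finC by (intro card_mono) auto
    also have "\<dots> \<le> card F'"
      unfolding C_def using F(2) by (intro card_image_le) (simp add: F'_def)
    also have "\<dots> \<le> card F"
      using F(2) by (intro card_mono) (auto simp: F'_def)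
    finally show ?thesis using F(3) by simp
  qed
  ultimately show ?thesis
    using sub unfolding local_covering_def covering_def
    by (intro exI[of _ C] conjI ballI; simp)
qed

section \<open>The lower bound\<close>

text \<open>Vertices on one side of a biclique share a neighbour on the nonempty other side. No
  vertex of the host graph is adjacent to both a singleton and a pair, so \<open>A\<close> and
  \<open>B\<close> lie on opposite sides.\<close>

lemma biclique_arc_G_P12:
  assumes "G \<in> complete_bipartite_graphs" "subgraph (with_proj G) (with_proj (G_P12 n))"
    and "A \<in> pverts G" "A \<in> layer 1 n" "B \<in> pverts G" "B \<in> layer 2 n"
  shows "(A, B) \<in> parcs G"
proof -
  obtain U V where UV: "U \<noteq> {}" "V \<noteq> {}" "G = biclique U V"
    using assms(1) by (auto simp: complete_bipartite_graphs_iff)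
  have sub: "(x, y) \<in> parcs (G_P12 n)" if "(x, y) \<in> parcs G" for x y
    using assms(2) that by (auto simp: subgraph_def)
  have "x \<notin> layer 1 n \<or> y \<notin> layer 2 n" if "(x, w) \<in> parcs G" "(y, w) \<in> parcs G" for x y w
    using sub[OF that(1)] sub[OF that(2)] layer_disjoint[of 1 2 n] by (auto simp: parcs_G_P12)
  then show ?thesis
    using UV assms(3-6) by auto
qed

lemma local_covering_G_P12_bound:
  assumes "local_covering k complete_bipartite_graphs (G_P12 n) C"
  shows "n - 1 \<le> 4 ^ k"
proof -
  have C: "finite C" "C \<subseteq> complete_bipartite_graphs"
      "\<And>G. G \<in> C \<Longrightarrow> subgraph (with_proj G) (with_proj (G_P12 n))"
      "(\<Union>G\<in>C. parcs G) = parcs (G_P12 n)"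
    and loc: "\<And>v. v \<in> pverts (G_P12 n) \<Longrightarrow> card {G \<in> C. v \<in> pverts G} \<le> k"
    using assms by (auto simp: local_covering_def covering_def)
  \<comment> \<open>A set \<open>D\<close> of bicliques encodes the deletion: those in
    \<open>D\<close> lose their side of singletons, the others their side of pairs. Then
    \<open>{j, n}\<close> survives iff \<open>P j \<subseteq> D\<close>, and \<open>{j}\<close>
    survives iff \<open>D\<close> avoids \<open>Q j\<close>.\<close>
  define P where "P j = {G \<in> C. {j, n} \<in> pverts G}" for j
  define Q where "Q j = {G \<in> C. {j} \<in> pverts G}" for j
  have l1: "{j} \<in> layer 1 n" and l2: "{j, n} \<in> layer 2 n" if "j \<in> {1..<n}" for j
    using that by (auto simp: layer_def)
  have "card {1..<n} \<le> 2 ^ (2 * k)"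
  proof (rule card_le_cross_intersecting[of C _ P Q])
    fix j assume j: "j \<in> {1..<n}"
    have "P j \<inter> Q j = {}"
    \<comment> \<open>A biclique through both vertices would contain an arc between them, but
      \<open>{j}\<close> lies inside \<open>{j, n}\<close>.\<close>
    proof (rule ccontr)
      assume "P j \<inter> Q j \<noteq> {}"
      then obtain G where G: "G \<in> C" "{j, n} \<in> pverts G" "{j} \<in> pverts G"
        by (auto simp: P_def Q_def)
      then have "({j}, {j, n}) \<in> parcs G"
        using C(2,3) l1[OF j] l2[OF j] by (intro biclique_arc_G_P12) auto
      then have "({j}, {j, n}) \<in> parcs (G_P12 n)" using C(4) G(1) by blast
      then show False using l2[OF j] layer_disjoint[of 1 2 n] by (auto simp: parcs_G_P12)
    qed
    then show "P j \<subseteq> C \<and> Q j \<subseteq> C \<and> P j \<inter> Q j = {}"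
      by (auto simp: P_def Q_def)
    show "card (P j) + card (Q j) \<le> 2 * k"
      using loc[of "{j}"] loc[of "{j, n}"] l1[OF j] l2[OF j]
      by (simp add: P_def Q_def pverts_G_P12)
  next
    fix i j assume ij: "i \<in> {1..<n}" "j \<in> {1..<n}" "i \<noteq> j"
    \<comment> \<open>Some biclique must cover this arc, and it then lies in both \<open>P i\<close>
      and \<open>Q j\<close>.\<close>
    then have "({j}, {i, n}) \<in> parcs (G_P12 n)"
      using l1[OF ij(2)] l2[OF ij(1)] by (auto simp: parcs_G_P12)
    then obtain G where G: "G \<in> C" "({j}, {i, n}) \<in> parcs G" using C(4) by blast
    then obtain U V where "G = biclique U V"
      using subsetD[OF C(2) G(1)] unfolding complete_bipartite_graphs_iff by blast
    then have "G \<in> P i \<inter> Q j" using G by (auto simp: P_def Q_def)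
    then show "P i \<inter> Q j \<noteq> {}" by blast
  qed (use C(1) in auto)
  then show ?thesis by (simp add: power_mult)
qed

section \<open>Logarithmic bounds on \<open>lc\<close>\<close>

lemma lc_G_P12_upper:
  assumes "3 \<le> n"
  shows "real (lc complete_bipartite_graphs (G_P12 n)) \<le> (3 / ln (8 / 7) + 1) * ln (real n)"
    and "\<exists>C. local_covering (lc complete_bipartite_graphs (G_P12 n)) complete_bipartite_graphs
           (G_P12 n) C"
proof -
  \<comment> \<open>The least natural number strictly above 3 ln n / ln (8/7), the threshold beyond
    which n^3 * 7^k < 8^k.\<close>
  define k where "k = nat \<lfloor>3 * ln (real n) / ln (8 / 7)\<rfloor> + 1"
  \<comment> \<open>Since n is at least 3 > e, the additive 1 from rounding can be absorbed into the
    factor of ln n.\<close>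
  have n: "1 \<le> ln (real n)"
    using assms exp_le by (subst ln_ge_iff) auto
  have pos: "0 < ln (8 / 7 :: real)" by simp
  have "3 * ln (real n) / ln (8 / 7) < real k"
    unfolding k_def by linarith
  then have "3 * ln (real n) < real k * ln (8 / 7)"
    using pos by (simp add: field_simps)
  then have "ln (real n ^ 3) < ln ((8 / 7) ^ k)"
    using assms by (simp add: ln_realpow)
  then have "real n ^ 3 < (8 / 7) ^ k"
    using assms by (subst (asm) ln_less_cancel_iff) auto
  then have "real (n ^ 3 * 7 ^ k) < real (8 ^ k)"
    by (simp add: power_divide field_simps)
  then have "n ^ 3 * 7 ^ k < 8 ^ k"
    by (simp only: of_nat_less_iff)
  then have ex: "\<exists>C. local_covering k complete_bipartite_graphs (G_P12 n) C"
    using assms by (intro ex_local_covering_G_P12)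
  \<comment> \<open>Existence of some covering makes the \<open>LEAST\<close> in \<open>lc\<close>
    attained; the lower bound needs a covering that realises this value.\<close>
  then show "\<exists>C. local_covering (lc complete_bipartite_graphs (G_P12 n)) complete_bipartite_graphs
           (G_P12 n) C"
    unfolding lc_def by (rule LeastI)
  have "lc complete_bipartite_graphs (G_P12 n) \<le> k"
    unfolding lc_def using ex by (rule Least_le)
  moreover have "real k \<le> 3 * ln (real n) / ln (8 / 7) + 1"
    using n pos unfolding k_def by (simp add: nat_0_le)
  ultimately show "real (lc complete_bipartite_graphs (G_P12 n)) \<le> (3 / ln (8 / 7) + 1) * ln (real n)"
    using n by (simp add: algebra_simps)
qed

lemma lc_G_P12_lower:
  assumes "3 \<le> n"
  shows "ln (real n) \<le> ln 16 * real (lc complete_bipartite_graphs (G_P12 n))"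
proof -
  define k where "k = lc complete_bipartite_graphs (G_P12 n)"
  have "n - 1 \<le> 4 ^ k"
    using lc_G_P12_upper(2)[OF assms] local_covering_G_P12_bound unfolding k_def by blast
  \<comment> \<open>Squaring trades \<open>n - 1\<close> for \<open>n\<close>, at the price of base
    16 instead of 4.\<close>
  then have "(n - 1) ^ 2 \<le> (4 ^ k) ^ 2" by (rule power_mono) simp
  moreover have "n \<le> (n - 1) ^ 2"
  proof -
    obtain m where "n = m + 3" using assms by (metis add.commute le_Suc_ex)
    then show ?thesis by (simp add: power2_eq_square)
  qed
  moreover have "(4 ^ k) ^ 2 = (16 :: nat) ^ k"
    by (simp add: power2_eq_square flip: power_mult_distrib)
  ultimately have "n \<le> 16 ^ k" by linarith
  then have "real n \<le> 16 ^ k"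
    by (metis of_nat_le_iff of_nat_numeral of_nat_power)
  then have "ln (real n) \<le> ln (16 ^ k)"
    using assms by (subst ln_le_cancel_iff) auto
  then show ?thesis by (simp add: k_def ln_realpow mult.commute)
qed

theorem theorem10:
  shows "(\<lambda>n. real (lc complete_bipartite_graphs (G_P12 n))) \<in> \<Theta>(\<lambda>n. ln (real n))"
proof (rule bigthetaI)
  show "(\<lambda>n. real (lc complete_bipartite_graphs (G_P12 n))) \<in> O(\<lambda>n. ln (real n))"
  proof (rule bigoI)
    show "\<forall>\<^sub>F n in sequentially. norm (real (lc complete_bipartite_graphs (G_P12 n)))
        \<le> (3 / ln (8 / 7) + 1) * norm (ln (real n))"
      using eventually_ge_at_top[of 3] by eventually_elim (use lc_G_P12_upper(1) in simp)
  qed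
  show "(\<lambda>n. real (lc complete_bipartite_graphs (G_P12 n))) \<in> \<Omega>(\<lambda>n. ln (real n))"
  proof (rule landau_omega.bigI)
    show "\<forall>\<^sub>F n in sequentially. norm (real (lc complete_bipartite_graphs (G_P12 n)))
        \<ge> (1 / ln 16) * norm (ln (real n))"
      using eventually_ge_at_top[of 3]
      by eventually_elim (use lc_G_P12_lower in \<open>simp add: field_simps\<close>)
  qed simp
qed

end
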